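(* The posterior mean $\overline{\theta}=\alpha_d^{-1}\,\Sigma A^T(I_N\otimes M_u)\,d\in\mathbb{R}^p$ of the model discrepancy parameters is $$\overline{\theta}=\frac{1}{\alpha_d}\sum_{\ell=1}^N\left[\begin{pmatrix} a_\ell\, u_\ell\\ u_\ell\otimes M_z^{-1}W_z^{-1}(z_\ell-\tilde z)\end{pmatrix}-\sum_{i=1}^N b_{i,\ell}\begin{pmatrix} s_i\, u_{i,\ell}\\ u_{i,\ell}\otimes M_z^{-1}W_z^{-1}y_i\end{pmatrix}\right],$$ where, for $i,\ell=1,\dots,N$, $$a_\ell=1-\tilde z^TW_z^{-1}(z_\ell-\tilde z),\qquad b_{i,\ell}=(z_\ell-\tilde z)^TW_z^{-1}Zg_i+(e^Tg_i)\,a_\ell,$$ $$u_\ell=W_u^{-1}M_u d_\ell,\qquad u_{i,\ell}=(\alpha_d W_u+\mu_i M_u)^{-1}M_u u_\ell .$$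
   Context: Let $m,n,N$ be positive integers and $p=m(n+1)$. Let $M_u\in\mathbb{R}^{m\times m}$ and $M_z\in\mathbb{R}^{n\times n}$ be symmetric positive definite (mass) matrices, $W_u\in\mathbb{R}^{m\times m}$ and $W_z\in\mathbb{R}^{n\times n}$ symmetric positive definite (precision) matrices, $\alpha_d>0$, and $\tilde z\in\mathbb{R}^n$. Let $z_1,\dots,z_N\in\mathbb{R}^n$ be linearly independent (inputs) and $d_1,\dots,d_N\in\mathbb{R}^m$ (data); let $d\in\mathbb{R}^{mN}$ be the vector obtained by stacking $d_1,\dots,d_N$. $I_k$ is the $k\times k$ identity and $\otimes$ is the Kronecker product. The model discrepancy is $\delta(z,\theta)=\begin{pmatrix} I_m & I_m\otimes z^TM_z\end{pmatrix}\theta\in\mathbb{R}^m$ for $z\in\mathbb{R}^n$, $\theta\in\mathbb{R}^p$. Put $A_\ell=\begin{pmatrix} I_m & I_m\otimes z_\ell^TM_z\end{pmatrix}\in\mathbb{R}^{m\times p}$ and let $A\in\mathbb{R}^{mN\times p}$ be obtained by stacking $A_1,\dots,A_N$ vertically. The prior on $\Theta\in\mathbb{R}^p$ is Gaussian with mean $0$ and covariance $W_\theta^{-1}$, where $$W_\theta=\begin{pmatrix} W_u & W_u\otimes\tilde z^TM_z\\ W_u\otimes M_z\tilde z & W_u\otimes M_z(W_z+\tilde z\tilde z^T)M_z\end{pmatrix}\in\mathbb{R}^{p\times p}.$$ The data model is $d_\ell=A_\ell\Theta+\varepsilon_\ell$ with independent Gaussian noise $\varepsilon_\ell\sim\mathcal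 N(0,\alpha_d M_u^{-1})$. The posterior of $\Theta$ is then Gaussian with mean $\overline\theta=\alpha_d^{-1}\Sigma A^T(I_N\otimes M_u)d$ and covariance $\Sigma=\left(W_\theta+\alpha_d^{-1}A^T(I_N\otimes M_u)A\right)^{-1}$. Let $Z=\begin{pmatrix} z_1&\cdots&z_N\end{pmatrix}\in\mathbb{R}^{n\times N}$, let $e\in\mathbb{R}^N$ be the vector of ones, and $$G=ee^T+(Z-\tilde z e^T)^TW_z^{-1}(Z-\tilde z e^T)\in\mathbb{R}^{N\times N}.$$ Let $(g_i,\mu_i)$, $i=1,\dots,N$, be the eigenvectors and eigenvalues of $G$, with $g_1,\dots,g_N$ orthonormal in $\mathbb{R}^N$. Define $y_i=Zg_i-(e^Tg_i)\tilde z\in\mathbb{R}^n$ and $s_i=e^Tg_i-y_i^TW_z^{-1}\tilde z\in\mathbb{R}$. *)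

theory Defs
  imports "HOL-Analysis.Analysis"
begin

definition sym_pos_def :: "real^'k^'k \<Rightarrow> bool" where
  "sym_pos_def M \<longleftrightarrow> transpose M = M \<and> (\<forall>x. x \<noteq> 0 \<longrightarrow> 0 < x \<bullet> (M *v x))"

text \<open>Block vectors and block matrices have sum types as index types. As a matrix is a vector of
  rows, \<open>vstack\<close> also stacks matrices vertically.\<close>

definition vstack :: "'a^'k \<Rightarrow> 'a^'l \<Rightarrow> 'a^('k + 'l)" where
  "vstack x y = (\<chi> k. case k of Inl i \<Rightarrow> x $ i | Inr j \<Rightarrow> y $ j)"

definition hstack :: "'a^'k^'r \<Rightarrow> 'a^'l^'r \<Rightarrow> 'a^('k + 'l)^'r" where
  "hstack A B = (\<chi> i. vstack (A $ i) (B $ i))"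

text \<open>Kronecker products are indexed by pairs (in place of the lexicographic numbering of pairs).
  The variants \<open>kron_row\<close>, \<open>kron_col\<close> and \<open>kron_vec\<close> are \<open>A \<otimes> y\<^sup>T\<close>, \<open>A \<otimes> y\<close> and \<open>x \<otimes> y\<close> for
  (column) vectors \<open>x\<close> and \<open>y\<close>; they only drop the one-element index type of the dimension
  of length 1.\<close>

definition kron :: "real^'k^'r \<Rightarrow> real^'l^'s \<Rightarrow> real^('k \<times> 'l)^('r \<times> 's)" where
  "kron A B = (\<chi> i j. A $ fst i $ fst j * B $ snd i $ snd j)"

definition kron_row :: "real^'k^'r \<Rightarrow> real^'l \<Rightarrow> real^('k \<times> 'l)^'r" where
  "kron_row A y = (\<chi> i j. A $ i $ fst j * y $ snd j)"

definition kron_col :: "real^'k^'r \<Rightarrow> real^'l \<Rightarrow> real^'k^('r \<times> 'l)" where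
  "kron_col A y = (\<chi> i j. A $ fst i $ j * y $ snd i)"

definition kron_vec :: "real^'k \<Rightarrow> real^'l \<Rightarrow> real^('k \<times> 'l)" where
  "kron_vec x y = (\<chi> i. x $ fst i * y $ snd i)"

definition outer :: "real^'r \<Rightarrow> real^'k \<Rightarrow> real^'k^'r" where
  "outer x y = (\<chi> i j. x $ i * y $ j)"

definition ones :: "real^'k" where
  "ones = (\<chi> i. 1)"

definition gaussian_density :: "real^'k \<Rightarrow> real^'k^'k \<Rightarrow> real^'k \<Rightarrow> real" where
  "gaussian_density \<mu> C x =
     exp (- ((x - \<mu>) \<bullet> (matrix_inv C *v (x - \<mu>))) / 2) / sqrt ((2 * pi) ^ CARD('k) * det C)"

text \<open>With \<open>m = CARD('m)\<close> and \<open>n = CARD('n)\<close>, the parameter space has the index type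
  \<^typ>\<open>'m + 'm \<times> 'n\<close>, of cardinality \<open>m (n + 1)\<close>.\<close>

definition obs_block :: "real^'n^'n \<Rightarrow> real^'n \<Rightarrow> real^('m::finite + 'm \<times> 'n)^'m" where
  "obs_block Mz z = hstack (mat 1) (kron_row (mat 1) (z v* Mz))"

definition discrepancy ::
    "real^'n^'n \<Rightarrow> real^'n \<Rightarrow> real^('m::finite + 'm \<times> 'n) \<Rightarrow> real^'m" where
  "discrepancy Mz z \<theta> = obs_block Mz z *v \<theta>"

definition obs_matrix ::
    "real^'n^'n \<Rightarrow> ('N::finite \<Rightarrow> real^'n) \<Rightarrow> real^('m::finite + 'm \<times> 'n)^('N \<times> 'm)" where
  "obs_matrix Mz z = (\<chi> i. obs_block Mz (z (fst i)) $ snd i)"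

definition data_vec :: "('N::finite \<Rightarrow> real^'m) \<Rightarrow> real^('N \<times> 'm)" where
  "data_vec d = (\<chi> i. d (fst i) $ snd i)"

definition prior_precision ::
    "real^'n^'n \<Rightarrow> real^'m^'m \<Rightarrow> real^'n^'n \<Rightarrow> real^'n
      \<Rightarrow> real^('m::finite + 'm \<times> 'n)^('m + 'm \<times> 'n)" where
  "prior_precision Mz Wu Wz zt =
     vstack (hstack Wu (kron_row Wu (zt v* Mz)))
            (hstack (kron_col Wu (Mz *v zt)) (kron Wu (Mz ** (Wz + outer zt zt) ** Mz)))"

text \<open>The posterior is given by Bayes' rule: its density is the joint density of the
  parameter and the data \<open>d\<close>, normalized in the parameter. Given \<open>\<theta>\<close>, the data
  \<open>d l\<close> are independent and Gaussian with mean \<open>discrepancy Mz (z l) \<theta>\<close> and covariance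
  \<open>\<alpha>\<close> times the inverse of \<open>Mu\<close>.\<close>

definition prior_density ::
    "real^'n^'n \<Rightarrow> real^'m^'m \<Rightarrow> real^'n^'n \<Rightarrow> real^'n \<Rightarrow> real^('m::finite + 'm \<times> 'n) \<Rightarrow> real" where
  "prior_density Mz Wu Wz zt = gaussian_density 0 (matrix_inv (prior_precision Mz Wu Wz zt))"

definition likelihood ::
    "real \<Rightarrow> real^'m^'m \<Rightarrow> real^'n^'n \<Rightarrow> ('N::finite \<Rightarrow> real^'n) \<Rightarrow> ('N \<Rightarrow> real^'m)
      \<Rightarrow> real^('m::finite + 'm \<times> 'n) \<Rightarrow> real" where
  "likelihood \<alpha> Mu Mz z d \<theta> =
     (\<Prod>l\<in>UNIV. gaussian_density (discrepancy Mz (z l) \<theta>) (\<alpha> *\<^sub>R matrix_inv Mu) (d l))"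

definition posterior ::
    "real \<Rightarrow> real^'m^'m \<Rightarrow> real^'n^'n \<Rightarrow> real^'m^'m \<Rightarrow> real^'n^'n \<Rightarrow> real^'n
      \<Rightarrow> ('N::finite \<Rightarrow> real^'n) \<Rightarrow> ('N \<Rightarrow> real^'m) \<Rightarrow> (real^('m::finite + 'm \<times> 'n)) measure" where
  "posterior \<alpha> Mu Mz Wu Wz zt z d =
     (let joint = (\<lambda>\<theta>. prior_density Mz Wu Wz zt \<theta> * likelihood \<alpha> Mu Mz z d \<theta>)
      in density lborel (\<lambda>\<theta>. ennreal (joint \<theta> / (LINT \<tau>|lborel. joint \<tau>))))"

definition posterior_cov ::
    "real \<Rightarrow> real^'m^'m \<Rightarrow> real^'n^'n \<Rightarrow> real^'m^'m \<Rightarrow> real^'n^'n \<Rightarrow> real^'n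
      \<Rightarrow> ('N::finite \<Rightarrow> real^'n) \<Rightarrow> real^('m::finite + 'm \<times> 'n)^('m + 'm \<times> 'n)" where
  "posterior_cov \<alpha> Mu Mz Wu Wz zt z =
     (let A = (obs_matrix Mz z :: real^('m::finite + 'm \<times> 'n)^('N \<times> 'm))
      in matrix_inv (prior_precision Mz Wu Wz zt
           + (1 / \<alpha>) *\<^sub>R (transpose A ** kron (mat 1) Mu ** A)))"

end

theory Submission
  imports Defs "HOL-Probability.Distributions"
begin

text \<open>Identify the parameter space with \<open>\<real>\<^sup>m \<otimes> (\<real> \<times> \<real>\<^sup>n)\<close>. The prior precision becomes a Kronecker
  product \<open>W = Wu \<otimes> B\<close>, and the observation at \<open>z\<^sub>l\<close> becomes the contraction of the second factor
  with the vector \<open>c\<^sub>l = (1, Mz z\<^sub>l)\<close>. Hence the posterior precision is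
  \<open>P = Wu \<otimes> B + 1/\<alpha> Mu \<otimes> C C\<^sup>T\<close>, where \<open>C\<close> has the columns \<open>c\<^sub>l\<close>, and the normal equations read
  \<open>P \<theta> = 1/\<alpha> (\<Sum>l. Mu d\<^sub>l \<otimes> c\<^sub>l)\<close>.

  Without the data term, \<open>P\<close> is inverted factor by factor: the vector
  \<open>E\<^sub>l = B\<^sup>-\<^sup>1 c\<^sub>l = (a\<^sub>l, Mz\<^sup>-\<^sup>1 Wz\<^sup>-\<^sup>1 (z\<^sub>l - zt))\<close> gives the
  first term of the formula. The data term adds the error \<open>1/\<alpha> Mu u\<^sub>l \<otimes> C C\<^sup>T E\<^sub>l\<close>. The matrix
  \<open>G = C\<^sup>T B\<^sup>-\<^sup>1 C\<close> diagonalizes it: for an eigenvector \<open>g\<^sub>i\<close> put \<open>F\<^sub>i = B\<^sup>-\<^sup>1 C g\<^sub>i = (s\<^sub>i, Mz\<^sup>-\<^sup>1 Wz\<^sup>-\<^sup>1 y\<^sub>i)\<close>. Then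
  \<open>C C\<^sup>T F\<^sub>i = \<mu>\<^sub>i B F\<^sub>i\<close>, so that \<open>P (x \<otimes> F\<^sub>i) = 1/\<alpha> ((\<alpha> Wu + \<mu>\<^sub>i Mu) x) \<otimes> B F\<^sub>i\<close>
  (lemma \<open>posterior_precision_generalized_eigenvector\<close>), and the error is corrected by solving with
  \<open>\<alpha> Wu + \<mu>\<^sub>i Mu\<close> in each eigendirection. The coefficients \<open>b\<^sub>i\<^sub>l = c\<^sub>l \<bullet> F\<^sub>i\<close> are those of the \<open>l\<close>-th column of
  \<open>G\<close> in the basis \<open>g\<^sub>i\<close>.

  For the posterior itself, completing the square (lemma \<open>joint_density_gaussian\<close>) shows that the
  joint density is a nonzero constant times \<open>exp (- (\<theta> - m) \<bullet> P (\<theta> - m) / 2)\<close>, with \<open>m\<close> the solution of the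
  normal equations. Its normalization has mean \<open>m\<close> because the centred weight is even and integrable
  (lemma \<open>gaussian_mean\<close>). Positive definiteness of \<open>P\<close>, which the integrability rests on, needs that a
  Kronecker product of positive definite matrices is positive definite; writing \<open>Wz\<close> as a sum of
  squares (lemma \<open>sym_pos_def_sum_of_squares\<close>) reduces this to positive definiteness of \<open>Wu\<close>.\<close>

section \<open>Symmetric positive definite matrices\<close>

lemma outer_mult: "outer x y *v w = (y \<bullet> w) *\<^sub>R x"
  by (simp add: vec_eq_iff outer_def matrix_vector_mult_def inner_vec_def sum_distrib_right mult_ac
      sum_distrib_left)

lemma symmetric_inner_commute:
  fixes M :: "real^'k^'k"
  assumes "transpose M = M"
  shows "x \<bullet> (M *v y) = (M *v x) \<bullet> y"
  using assms by (metis dot_lmul_matrix transpose_matrix_vector)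

lemma sym_pos_def_inner_commute:
  assumes "sym_pos_def M"
  shows "x \<bullet> (M *v y) = (M *v x) \<bullet> y"
  using assms symmetric_inner_commute unfolding sym_pos_def_def by blast

lemma sym_pos_def_inner_swap:
  assumes "sym_pos_def M"
  shows "x \<bullet> (M *v y) = y \<bullet> (M *v x)"
  using sym_pos_def_inner_commute[OF assms] by (metis inner_commute)

lemma sym_pos_def_nonneg: "sym_pos_def M \<Longrightarrow> 0 \<le> x \<bullet> (M *v x)"
  unfolding sym_pos_def_def by (cases "x = 0") (auto simp: less_imp_le)

lemma sym_pos_def_eq_0: "sym_pos_def M \<Longrightarrow> x \<bullet> (M *v x) = 0 \<longleftrightarrow> x = 0"
  unfolding sym_pos_def_def by (cases "x = 0") (auto simp: less_le)

lemma sym_pos_defI: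
  fixes M :: "real^'k^'k"
  assumes "\<And>x y. x \<bullet> (M *v y) = (M *v x) \<bullet> y" and "\<And>x. x \<noteq> 0 \<Longrightarrow> 0 < x \<bullet> (M *v x)"
  shows "sym_pos_def M"
proof -
  have "M $ i $ j = M $ j $ i" for i j
    using assms(1)[of "axis i 1" "axis j 1"]
    by (simp add: matrix_vector_mult_basis inner_axis inner_axis' column_def)
  then show ?thesis
    using assms(2) by (simp add: sym_pos_def_def transpose_def vec_eq_iff)
qed

lemma sym_pos_def_scaleR:
  assumes "sym_pos_def M" and "c > 0"
  shows "sym_pos_def (c *\<^sub>R M)"
  using assms by (auto simp: sym_pos_def_def transpose_scalar scaleR_matrix_vector_assoc[symmetric])

lemma sym_pos_def_add_semidef:
  fixes M L :: "real^'k^'k"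
  assumes M: "sym_pos_def M" and L: "\<And>x y. x \<bullet> (L *v y) = (L *v x) \<bullet> y" "\<And>x. 0 \<le> x \<bullet> (L *v x)"
    and "c \<ge> 0"
  shows "sym_pos_def (M + c *\<^sub>R L)"
proof (rule sym_pos_defI)
  show "x \<bullet> ((M + c *\<^sub>R L) *v y) = ((M + c *\<^sub>R L) *v x) \<bullet> y" for x y
    by (simp add: matrix_vector_mult_add_rdistrib scaleR_matrix_vector_assoc[symmetric]
        inner_simps sym_pos_def_inner_commute[OF M] L(1))
next
  fix x :: "real^'k" assume "x \<noteq> 0"
  then have "0 < x \<bullet> (M *v x)" using M by (simp add: sym_pos_def_def)
  moreover have "0 \<le> c * (x \<bullet> (L *v x))" using L(2) \<open>c \<ge> 0\<close> by simp
  ultimately show "0 < x \<bullet> ((M + c *\<^sub>R L) *v x)"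
    by (simp add: matrix_vector_mult_add_rdistrib scaleR_matrix_vector_assoc[symmetric] inner_simps)
qed

lemma sym_pos_def_invertible:
  assumes "sym_pos_def M"
  shows "invertible M"
proof -
  have "x = 0" if "M *v x = 0" for x
    using that assms sym_pos_def_eq_0[OF assms, of x] by simp
  then show ?thesis
    by (metis invertible_left_inverse matrix_left_invertible_ker)
qed

lemma sym_pos_def_mult_inv:
  assumes "sym_pos_def M"
  shows "M *v (matrix_inv M *v x) = x" and "matrix_inv M *v (M *v x) = x"
proof -
  have "M ** matrix_inv M = mat 1 \<and> matrix_inv M ** M = mat 1"
    using sym_pos_def_invertible[OF assms] unfolding invertible_def matrix_inv_def
    by (rule someI_ex)
  then show "M *v (matrix_inv M *v x) = x" "matrix_inv M *v (M *v x) = x"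
    by (simp_all add: matrix_vector_mul_assoc)
qed

lemma sym_pos_def_inv_inner_commute:
  assumes "sym_pos_def M"
  shows "x \<bullet> (matrix_inv M *v y) = (matrix_inv M *v x) \<bullet> y"
  using sym_pos_def_inner_commute[OF assms, of "matrix_inv M *v x" "matrix_inv M *v y"]
  by (simp add: sym_pos_def_mult_inv[OF assms])

lemma sym_pos_def_inv:
  assumes "sym_pos_def M"
  shows "sym_pos_def (matrix_inv M)"
proof (rule sym_pos_defI)
  show "x \<bullet> (matrix_inv M *v y) = (matrix_inv M *v x) \<bullet> y" for x y
    by (rule sym_pos_def_inv_inner_commute[OF assms])
next
  fix x :: "real^'a" assume "x \<noteq> 0"
  define w where "w = matrix_inv M *v x"
  have x: "x = M *v w" by (simp add: w_def sym_pos_def_mult_inv[OF assms])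
  with \<open>x \<noteq> 0\<close> have "w \<noteq> 0" by auto
  then have "0 < w \<bullet> (M *v w)" using assms by (simp add: sym_pos_def_def)
  then show "0 < x \<bullet> (matrix_inv M *v x)"
    by (simp add: x sym_pos_def_mult_inv[OF assms] inner_commute)
qed

lemma matrix_inv_unique_eq:
  fixes M L :: "real^'k^'k"
  assumes "M ** L = mat 1"
  shows "matrix_inv M = L"
proof -
  have "L ** M = mat 1" using assms by (simp add: matrix_left_right_inverse)
  then have "invertible M" using assms invertible_def by blast
  then have "matrix_inv M ** M = mat 1" unfolding invertible_def matrix_inv_def
    by (rule someI2_ex) simp
  then have "matrix_inv M ** (M ** L) = L" by (simp add: matrix_mul_assoc)
  then show ?thesis by (simp add: assms)
qed

lemma sym_pos_def_inv_inv:
  assumes "sym_pos_def M"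
  shows "matrix_inv (matrix_inv M) = M"
  by (rule matrix_inv_unique_eq)
    (simp add: matrix_eq matrix_vector_mul_assoc[symmetric] sym_pos_def_mult_inv[OF assms])

lemma sym_pos_def_inv_scaleR_inv:
  assumes "sym_pos_def M" and "c > 0"
  shows "matrix_inv (c *\<^sub>R matrix_inv M) = (1 / c) *\<^sub>R M"
  using assms by (intro matrix_inv_unique_eq)
    (simp add: matrix_eq matrix_vector_mul_assoc[symmetric] sym_pos_def_mult_inv
      scaleR_matrix_vector_assoc[symmetric] matrix_vector_mult_scaleR)

lemma sym_pos_def_det_nonzero: "sym_pos_def M \<Longrightarrow> det M \<noteq> 0"
  using sym_pos_def_invertible invertible_det_nz by blast

text \<open>The constant is the minimum of the quadratic form on the unit sphere; it makes the Gaussian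
  weights below decay.\<close>

lemma sym_pos_def_coercive:
  fixes M :: "real^'k^'k"
  assumes "sym_pos_def M"
  obtains c where "c > 0" and "\<And>x. c * (norm x)\<^sup>2 \<le> x \<bullet> (M *v x)"
proof -
  let ?S = "sphere (0 :: real^'k) 1"
  have "continuous_on ?S (\<lambda>x. x \<bullet> (M *v x))"
    by (intro continuous_on_inner continuous_on_id matrix_vector_mult_linear_continuous_on)
  moreover have "?S \<noteq> {}" by simp
  ultimately have "\<exists>e\<in>?S. \<forall>x\<in>?S. e \<bullet> (M *v e) \<le> x \<bullet> (M *v x)"
    by (intro continuous_attains_inf) simp_all
  then obtain e where e: "e \<in> ?S" and min: "\<And>x. x \<in> ?S \<Longrightarrow> e \<bullet> (M *v e) \<le> x \<bullet> (M *v x)"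
    by blast
  have "(e \<bullet> (M *v e)) * (norm x)\<^sup>2 \<le> x \<bullet> (M *v x)" for x
  proof (cases "x = 0")
    case False
    define y where "y = (1 / norm x) *\<^sub>R x"
    have "e \<bullet> (M *v e) \<le> y \<bullet> (M *v y)" using False by (intro min) (simp add: y_def)
    also have "y \<bullet> (M *v y) = (x \<bullet> (M *v x)) / (norm x)\<^sup>2"
      by (simp add: y_def matrix_vector_mult_scaleR power2_eq_square)
    finally show ?thesis using False by (simp add: field_simps)
  qed simp
  moreover have "0 < e \<bullet> (M *v e)" using e assms by (cases "e = 0") (auto simp: sym_pos_def_def)
  ultimately show ?thesis using that by blast
qed

text \<open>Completing the square, one variable at a time. \<open>S\<close> collects the variables on which the form
  may still depend. If the diagonal entry of the next variable \<open>k\<close> is zero, the Cauchy-Schwarz inequality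
  kills the whole \<open>k\<close>-th column; otherwise subtracting one square leaves a semidefinite form that
  does not depend on \<open>k\<close>.\<close>

lemma semidef_sum_of_squares_on:
  fixes M :: "real^'k^'k"
  assumes "finite S" and "\<And>x y. x \<bullet> (M *v y) = (M *v x) \<bullet> y" and "\<And>x. 0 \<le> x \<bullet> (M *v x)"
    and "\<And>i. i \<notin> S \<Longrightarrow> M *v axis i 1 = 0"
  shows "\<exists>r. \<forall>x. M *v x = (\<Sum>i\<in>S. (r i \<bullet> x) *\<^sub>R r i)"
  using assms
proof (induction S arbitrary: M rule: finite_induct)
  case empty
  have "M *v x = 0" for x
  proof -
    have "(M *v x) \<bullet> axis i 1 = 0" for i
      using empty(1)[of x "axis i 1"] empty(3)[of i] by simp
    then show ?thesis by (simp add: vec_eq_iff inner_axis)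
  qed
  then show ?case by simp
next
  case (insert k S)
  note sym = insert.prems(1) and psd = insert.prems(2)
  let ?e = "axis k 1 :: real^'k"
  define p where "p = ?e \<bullet> (M *v ?e)"
  \<comment> \<open>Cauchy-Schwarz for the semidefinite form, from its values on the line through \<open>x\<close> in
    the direction of the \<open>k\<close>-th unit vector.\<close>
  have cs: "(x \<bullet> (M *v ?e))\<^sup>2 \<le> p * (x \<bullet> (M *v x))" for x
  proof -
    have quad: "0 \<le> x \<bullet> (M *v x) + 2 * t * (x \<bullet> (M *v ?e)) + t\<^sup>2 * p" for t
    proof -
      have "0 \<le> (x + t *\<^sub>R ?e) \<bullet> (M *v (x + t *\<^sub>R ?e))" by (rule psd)
      also have "\<dots> = x \<bullet> (M *v x) + 2 * t * (x \<bullet> (M *v ?e)) + t\<^sup>2 * p"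
        using sym[of ?e x]
        by (simp add: p_def matrix_vector_right_distrib matrix_vector_mult_scaleR inner_simps
            inner_commute power2_eq_square algebra_simps)
      finally show ?thesis .
    qed
    define q where "q = x \<bullet> (M *v ?e)"
    define w where "w = x \<bullet> (M *v x)"
    have "0 \<le> w" "0 \<le> p" using psd by (auto simp: w_def p_def)
    have "q\<^sup>2 \<le> p * w"
    proof (cases "p = 0")
      case True
      have "q = 0"
      proof (rule ccontr)
        assume "q \<noteq> 0"
        then have "2 * (- (w + 1) / (2 * q)) * q = - w - 1" by simp
        then show False
          using quad[of "- (w + 1) / (2 * q)"] True
          unfolding q_def[symmetric] w_def[symmetric] by auto
      qed
      then show ?thesis using True by simp
    next
      case False
      then have "0 < p" using \<open>0 \<le> p\<close> by simp
      have "2 * (- q / p) * q + (- q / p)\<^sup>2 * p = - (q\<^sup>2 / p)"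
        using \<open>0 < p\<close> by (simp add: power2_eq_square)
      then have "q\<^sup>2 / p \<le> w"
        using quad[of "- q / p"] unfolding q_def[symmetric] w_def[symmetric] by linarith
      then show ?thesis using \<open>0 < p\<close> by (simp add: pos_divide_le_eq mult.commute)
    qed
    then show ?thesis by (simp add: q_def w_def)
  qed
  \<comment> \<open>When \<open>p = 0\<close>, this vector is zero by \<open>1 / 0 = 0\<close>, so both cases split off \<open>outer \<rho> \<rho>\<close>.\<close>
  define \<rho> where "\<rho> = (1 / sqrt p) *\<^sub>R (M *v ?e)"
  define L where "L = M - outer \<rho> \<rho>"
  have L: "L *v x = M *v x - (\<rho> \<bullet> x) *\<^sub>R \<rho>" for x
    by (simp add: L_def matrix_vector_mult_diff_rdistrib outer_mult)
  have "0 \<le> p" using psd by (simp add: p_def)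
  have Lk: "L *v ?e = 0"
  proof (cases "p = 0")
    case True
    have "(M *v ?e) \<bullet> (M *v ?e) = 0" using cs[of "M *v ?e"] True by simp
    then show ?thesis using True by (simp add: L \<rho>_def)
  next
    case False
    have "(M *v ?e) \<bullet> ?e = p" unfolding p_def by (rule inner_commute)
    then have "\<rho> \<bullet> ?e = sqrt p"
      using \<open>0 \<le> p\<close> by (simp add: \<rho>_def real_div_sqrt)
    then show ?thesis using False \<open>0 \<le> p\<close> by (simp add: L \<rho>_def)
  qed
  have "\<exists>r. \<forall>x. L *v x = (\<Sum>i\<in>S. (r i \<bullet> x) *\<^sub>R r i)"
  proof (rule insert.IH)
    show "x \<bullet> (L *v y) = (L *v x) \<bullet> y" for x y
      using sym[of x y] by (simp add: L inner_simps inner_commute mult.commute)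
    show "0 \<le> x \<bullet> (L *v x)" for x
    proof -
      have "(\<rho> \<bullet> x)\<^sup>2 \<le> x \<bullet> (M *v x)"
      proof (cases "p = 0")
        case True
        then show ?thesis using psd by (simp add: \<rho>_def)
      next
        case False
        then have "0 < p" using \<open>0 \<le> p\<close> by simp
        then show ?thesis
          using cs[of x] by (simp add: \<rho>_def power_divide inner_commute field_simps)
      qed
      then show ?thesis by (simp add: L inner_simps inner_commute power2_eq_square)
    qed
    show "L *v axis i 1 = 0" if "i \<notin> S" for i
    proof (cases "i = k")
      case True
      then show ?thesis using Lk by simp
    next
      case False
      with that have Mi: "M *v axis i 1 = 0" using insert.prems(3) by simp
      have "\<rho> \<bullet> axis i 1 = 0"
        using sym[of ?e "axis i 1"] Mi by (simp add: \<rho>_def)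
      then show ?thesis by (simp add: L Mi)
    qed
  qed
  then obtain r where r: "\<And>x. L *v x = (\<Sum>i\<in>S. (r i \<bullet> x) *\<^sub>R r i)" by blast
  have "M *v x = (\<Sum>i\<in>insert k S. ((r(k := \<rho>)) i \<bullet> x) *\<^sub>R (r(k := \<rho>)) i)" for x
  proof -
    have "(\<Sum>i\<in>S. ((r(k := \<rho>)) i \<bullet> x) *\<^sub>R (r(k := \<rho>)) i) = L *v x"
      unfolding r using insert.hyps by (intro sum.cong) auto
    then show ?thesis using insert.hyps by (simp add: L)
  qed
  then show ?case by blast
qed

text \<open>This factorization plays the part of the spectral theorem: it is what makes the Kronecker product of two
  positive definite matrices positive definite.\<close>

lemma sym_pos_def_sum_of_squares:
  fixes M :: "real^'k^'k"
  assumes "sym_pos_def M"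
  obtains r :: "'k \<Rightarrow> real^'k" where "\<And>x. M *v x = (\<Sum>i\<in>UNIV. (r i \<bullet> x) *\<^sub>R r i)"
  using semidef_sum_of_squares_on[of UNIV M] sym_pos_def_inner_commute[OF assms]
    sym_pos_def_nonneg[OF assms] by auto

text \<open>A square matrix with orthonormal rows also has orthonormal columns, so an orthonormal family
  of full size is a basis.\<close>

lemma orthonormal_expansion:
  fixes g :: "'k \<Rightarrow> real^'k"
  assumes "\<And>i j. g i \<bullet> g j = (if i = j then 1 else 0)"
  shows "(\<Sum>i\<in>UNIV. (x \<bullet> g i) *\<^sub>R g i) = x"
proof -
  define Q where "Q = (\<chi> i. g i)"
  have "Q ** transpose Q = mat 1"
    using assms by (simp add: Q_def matrix_matrix_mult_def transpose_def mat_def vec_eq_iff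
        inner_vec_def)
  then have "transpose Q ** Q = mat 1" by (simp add: matrix_left_right_inverse)
  then have eq: "transpose Q *v (Q *v x) = x" by (simp add: matrix_vector_mul_assoc)
  have "(Q *v x) $ i = x \<bullet> g i" for i
    by (simp add: Q_def matrix_vector_mul_component inner_commute)
  moreover have "transpose Q *v w = (\<Sum>i\<in>UNIV. w $ i *\<^sub>R g i)" for w
    by (simp add: vec_eq_iff Q_def vector_matrix_mult_def mult.commute)
  ultimately show ?thesis using eq by simp
qed

section \<open>Means of Gaussian densities\<close>

lemma integrable_exp_neg_square:
  assumes "c > 0"
  shows "integrable lborel (\<lambda>x::real. exp (- c * x\<^sup>2))"
proof -
  define \<sigma> where "\<sigma> = sqrt (1 / (2 * c))"
  have \<sigma>: "\<sigma>\<^sup>2 = 1 / (2 * c)" "\<sigma> > 0" using assms by (simp_all add: \<sigma>_def)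
  have "exp (- c * x\<^sup>2) = sqrt (2 * pi * \<sigma>\<^sup>2) * normal_density 0 \<sigma> x" for x
    using assms by (simp add: normal_density_def \<sigma>(1))
  moreover have "integrable lborel (\<lambda>x. sqrt (2 * pi * \<sigma>\<^sup>2) * normal_density 0 \<sigma> x)"
    using \<sigma>(2) by (intro integrable_mult_right integrable_normal_density)
  ultimately show ?thesis by simp
qed

text \<open>The exponential of the squared norm factors over the coordinates, each factor being an
  unnormalized normal density.\<close>

lemma integrable_exp_neg_norm_square:
  assumes "c > 0"
  shows "integrable lborel (\<lambda>x::'a::euclidean_space. exp (- c * (norm x)\<^sup>2))"
proof (rule integrableI_bounded)
  let ?f = "\<lambda>t::real. ennreal (exp (- c * t\<^sup>2))"
  have eq: "exp (- c * (norm x)\<^sup>2) = (\<Prod>b\<in>Basis. exp (- c * (x \<bullet> b)\<^sup>2))" for x :: 'a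
  proof -
    have "(norm x)\<^sup>2 = (\<Sum>b\<in>Basis. (x \<bullet> b)\<^sup>2)"
      unfolding power2_norm_eq_inner by (subst euclidean_inner) (simp add: power2_eq_square)
    then show ?thesis by (simp add: exp_sum[symmetric] sum_distrib_left sum_negf)
  qed
  have val: "ennreal (norm (exp (- c * (norm x)\<^sup>2))) = (\<Prod>b\<in>Basis. ?f (x \<bullet> b))" for x :: 'a
    unfolding eq by (simp add: prod_ennreal abs_prod)
  have "(\<integral>\<^sup>+(x::'a). ennreal (norm (exp (- c * (norm x)\<^sup>2))) \<partial>lborel)
      = (\<integral>\<^sup>+(x::'a). (\<Prod>b\<in>Basis. ?f (x \<bullet> b)) \<partial>lborel)"
    by (intro nn_integral_cong) (simp only: val)
  also have "\<dots> = (\<Prod>b\<in>(Basis::'a set). (\<integral>\<^sup>+t. ?f t \<partial>lborel))"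
    by (rule nn_integral_lborel_prod) simp_all
  also have "(\<integral>\<^sup>+t. ?f t \<partial>lborel) = ennreal (integral\<^sup>L lborel (\<lambda>t::real. exp (- c * t\<^sup>2)))"
    by (intro nn_integral_eq_integral integrable_exp_neg_square assms) simp
  finally show "(\<integral>\<^sup>+(x::'a). ennreal (norm (exp (- c * (norm x)\<^sup>2))) \<partial>lborel) < \<infinity>"
    by (simp add: ennreal_power flip: top.not_eq_extremum)
qed simp

lemma integral_lborel_reflect:
  fixes f :: "'a::euclidean_space \<Rightarrow> 'b::{banach, second_countable_topology}"
  assumes "f \<in> borel_measurable borel"
  shows "(LINT x|lborel. f (- x)) = (LINT x|lborel. f x)"
proof -
  have "(lborel :: 'a measure) = density (distr lborel borel (\<lambda>x. 0 + (-1) *\<^sub>R x)) (\<lambda>_. 1)"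
    using lborel_affine[of "-1" "0::'a"] by simp
  then have "lborel = distr lborel borel (\<lambda>x::'a. - x)"
    by (simp add: density_1)
  then have "(LINT x|lborel. f x) = (LINT x|distr lborel borel (\<lambda>x::'a. - x). f x)" by simp
  also have "\<dots> = (LINT x|lborel. f (- x))"
    using assms by (intro integral_distr) simp_all
  finally show ?thesis by simp
qed

lemma has_bochner_integral_lborel_shift:
  fixes f :: "'a::euclidean_space \<Rightarrow> 'b::{banach, second_countable_topology}"
  assumes "has_bochner_integral lborel f I"
  shows "has_bochner_integral lborel (\<lambda>x. f (x - m)) I"
proof -
  have [measurable]: "f \<in> borel_measurable borel" using assms by (auto elim: has_bochner_integral.cases)
  have "has_bochner_integral lborel (\<lambda>x. (\<lambda>y. f (y - m)) (m + x)) I" using assms by simp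
  then have "has_bochner_integral (distr lborel borel ((+) m)) (\<lambda>y. f (y - m)) I"
    by (rule has_bochner_integral_distr[rotated 2]) simp_all
  then show ?thesis by (simp add: lborel_distr_plus)
qed

lemma borel_measurable_matrix_vector_mult [measurable]:
  fixes P :: "real^'k^'l"
  assumes "f \<in> borel_measurable M"
  shows "(\<lambda>x. P *v f x) \<in> borel_measurable M"
  by (rule borel_measurable_continuous_on[OF matrix_vector_mult_linear_continuous_on assms])

text \<open>Coercivity bounds the weight by a radial Gaussian; half of the decay absorbs the factor \<open>x\<close>.\<close>

lemma gaussian_integral_pos:
  fixes P :: "real^'k^'k"
  assumes "sym_pos_def P"
  shows "integrable lborel (\<lambda>x. exp (- (x \<bullet> (P *v x)) / 2))"
    and "0 < (LINT x|lborel. exp (- (x \<bullet> (P *v x)) / 2))"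
    and "integrable lborel (\<lambda>x. exp (- (x \<bullet> (P *v x)) / 2) *\<^sub>R x)"
proof -
  let ?h = "\<lambda>x. exp (- (x \<bullet> (P *v x)) / 2)"
  obtain c where c: "c > 0" and coercive: "\<And>x. c * (norm x)\<^sup>2 \<le> x \<bullet> (P *v x)"
    using sym_pos_def_coercive[OF assms] by blast
  show int: "integrable lborel ?h"
  proof (rule Bochner_Integration.integrable_bound)
    show "integrable lborel (\<lambda>x::real^'k. exp (- (c / 2) * (norm x)\<^sup>2))"
      using c by (intro integrable_exp_neg_norm_square) simp
    show "AE x in lborel. norm (?h x) \<le> norm (exp (- (c / 2) * (norm x)\<^sup>2))"
      using coercive by (intro AE_I2) (simp add: field_simps)
  qed simp
  show "integrable lborel (\<lambda>x. ?h x *\<^sub>R x)"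
  proof (rule Bochner_Integration.integrable_bound)
    define K where "K = max 1 (4 / c)"
    show "integrable lborel (\<lambda>x::real^'k. K * exp (- (c / 4) * (norm x)\<^sup>2))"
      using c by (intro integrable_mult_right integrable_exp_neg_norm_square) simp
    have "norm (?h x *\<^sub>R x) \<le> norm (K * exp (- (c / 4) * (norm x)\<^sup>2))" for x
    proof -
      define t where "t = norm x"
      \<comment> \<open>A linear factor costs at most a constant times \<open>exp (c / 4 * t\<^sup>2)\<close>, half of the available
        exponent.\<close>
      have "t \<le> 1 + t\<^sup>2"
        using zero_le_power2[of "t - 1"] by (simp add: power2_diff) (smt (verit) zero_le_power2)
      also have "\<dots> \<le> K * (1 + c / 4 * t\<^sup>2)"
      proof -
        have "1 \<le> K" "1 \<le> K * (c / 4)" using c by (auto simp: K_def max_def field_simps)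
        then show ?thesis
          using mult_right_mono[of 1 "K * (c / 4)" "t\<^sup>2"] by (simp add: algebra_simps)
      qed
      also have "\<dots> \<le> K * exp (c / 4 * t\<^sup>2)"
        by (intro mult_left_mono exp_ge_add_one_self) (simp add: K_def)
      finally have t: "t \<le> K * exp (c / 4 * t\<^sup>2)" .
      have "norm (?h x *\<^sub>R x) = ?h x * t" by (simp add: t_def)
      also have "\<dots> \<le> exp (- (c / 2) * t\<^sup>2) * (K * exp (c / 4 * t\<^sup>2))"
        using coercive[of x] t by (intro mult_mono) (simp_all add: t_def)
      also have "\<dots> = K * (exp (- (c / 2) * t\<^sup>2) * exp (c / 4 * t\<^sup>2))" by simp
      also have "exp (- (c / 2) * t\<^sup>2) * exp (c / 4 * t\<^sup>2) = exp (- (c / 4) * t\<^sup>2)"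
        unfolding exp_add[symmetric] by simp
      finally show ?thesis by (simp add: t_def)
    qed
    then show "AE x in lborel. norm (?h x *\<^sub>R x) \<le> norm (K * exp (- (c / 4) * (norm x)\<^sup>2))" by simp
  qed simp
  have "(LINT x|lborel. ?h x) \<noteq> 0"
  proof
    assume "(LINT x|lborel. ?h x) = 0"
    then have "AE x in lborel. ?h x = 0"
      using int by (subst (asm) integral_nonneg_eq_0_iff_AE) simp_all
    then have "AE x in (lborel :: (real^'k) measure). False" by simp
    then have "emeasure (lborel :: (real^'k) measure) UNIV = 0"
      by (subst (asm) AE_iff_measurable[where N = UNIV]) simp_all
    then show False by simp
  qed
  then show "0 < (LINT x|lborel. ?h x)"
    by (simp add: less_le integral_nonneg_AE)
qed

text \<open>The factor \<open>K\<close> cancels in the normalization, which spares evaluating a Gaussian integral in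
  terms of a determinant. The centred weight is even, so its first moment
  vanishes and only the shift by \<open>m\<close> remains.\<close>

lemma gaussian_mean:
  fixes P :: "real^'k^'k"
  assumes P: "sym_pos_def P" and "K \<noteq> 0"
    and f: "\<And>x. f x = K * exp (- ((x - m) \<bullet> (P *v (x - m))) / 2)"
  shows "has_bochner_integral (density lborel (\<lambda>x. ennreal (f x / (LINT t|lborel. f t)))) (\<lambda>x. x) m"
proof -
  let ?h = "\<lambda>x. exp (- (x \<bullet> (P *v x)) / 2)"
  define I where "I = (LINT x|lborel. ?h x)"
  have "I > 0" unfolding I_def by (rule gaussian_integral_pos(2)[OF P])
  have h: "has_bochner_integral lborel ?h I"
    unfolding I_def by (intro has_bochner_integral_integrable gaussian_integral_pos P)
  have "(LINT x|lborel. ?h x *\<^sub>R x) = 0"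
  proof -
    have "(LINT x|lborel. ?h x *\<^sub>R x) = (LINT x|lborel. ?h (- x) *\<^sub>R (- x))"
      by (rule integral_lborel_reflect[symmetric]) simp
    also have "\<dots> = - (LINT x|lborel. ?h x *\<^sub>R x)"
      by (simp add: linear_neg[OF matrix_vector_mul_linear])
    finally have "2 *\<^sub>R (LINT x|lborel. ?h x *\<^sub>R x) = 0"
      by (simp add: scaleR_2 eq_neg_iff_add_eq_0)
    then show ?thesis by (simp only: scaleR_eq_0_iff) simp
  qed
  then have hx: "has_bochner_integral lborel (\<lambda>x. ?h x *\<^sub>R x) 0"
    using has_bochner_integral_integrable[OF gaussian_integral_pos(3)[OF P]] by simp
  have "has_bochner_integral lborel (\<lambda>x. K * ?h (x - m)) (K * I)"
    by (intro has_bochner_integral_mult_right has_bochner_integral_lborel_shift[OF h])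
  then have "(LINT t|lborel. f t) = K * I"
    unfolding f by (rule has_bochner_integral_integral_eq)
  then have w: "f x / (LINT t|lborel. f t) = ?h (x - m) / I" for x
    using \<open>K \<noteq> 0\<close> by (simp add: f)
  have "has_bochner_integral lborel (\<lambda>x. (1 / I) *\<^sub>R (?h x *\<^sub>R x + ?h x *\<^sub>R m))
      ((1 / I) *\<^sub>R (0 + I *\<^sub>R m))"
    by (intro has_bochner_integral_scaleR_right has_bochner_integral_add hx
        has_bochner_integral_scaleR_left h)
  from has_bochner_integral_lborel_shift[OF this, of m]
  have "has_bochner_integral lborel (\<lambda>x. (?h (x - m) / I) *\<^sub>R x) m"
    using \<open>I > 0\<close> by (simp add: scaleR_add_right[symmetric])
  then show ?thesis
    unfolding w using \<open>I > 0\<close> by (intro has_bochner_integral_density) simp_all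
qed

section \<open>The parameter space as a tensor product\<close>

text \<open>A parameter vector is an element of \<open>\<real>\<^sup>m \<otimes> (\<real> \<times> \<real>\<^sup>n)\<close>: the index \<open>Inl j\<close> carries the
  constant part and \<open>Inr (j, k)\<close> the part linear in the input, of output component \<open>j\<close>.
  The three maps below are the components of such a tensor, the elementary tensors, and the
  contraction with a fixed vector of the second factor, which is adjoint to forming elementary tensors.\<close>

definition slice :: "real^('m::finite + 'm \<times> 'n::finite) \<Rightarrow> 'm \<Rightarrow> real \<times> (real^'n)" where
  "slice \<theta> j = (\<theta> $ Inl j, \<chi> k. \<theta> $ Inr (j, k))"

definition elem_tensor :: "real^'m \<Rightarrow> real \<times> (real^'n) \<Rightarrow> real^('m::finite + 'm \<times> 'n::finite)" where
  "elem_tensor x c = vstack (fst c *\<^sub>R x) (kron_vec x (snd c))"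

definition contract :: "real \<times> (real^'n) \<Rightarrow> real^('m::finite + 'm \<times> 'n::finite) \<Rightarrow> real^'m" where
  "contract c \<theta> = (\<chi> j. c \<bullet> slice \<theta> j)"

lemma sum_UNIV_Plus:
  "(\<Sum>k\<in>UNIV. f k) = (\<Sum>i\<in>UNIV. f (Inl i)) + (\<Sum>j\<in>UNIV. f (Inr j))"
  for f :: "'a::finite + 'b::finite \<Rightarrow> 'c::comm_monoid_add"
  by (subst UNIV_Plus_UNIV[symmetric], subst sum.Plus) (simp_all add: comp_def)

lemma sum_UNIV_Times:
  "(\<Sum>k\<in>UNIV. f k) = (\<Sum>i\<in>UNIV. \<Sum>j\<in>UNIV. f (i, j))"
  for f :: "'a::finite \<times> 'b::finite \<Rightarrow> 'c::comm_monoid_add"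
  by (simp add: sum.cartesian_product)

lemma sum_if_zero: "(\<Sum>j\<in>A. if b then f j else 0) = (if b then (\<Sum>j\<in>A. f j) else 0)"
  by simp

lemma slice_eqI: "\<theta> = \<theta>'" if "\<And>j. slice \<theta> j = slice \<theta>' j"
proof -
  have "\<theta> $ k = \<theta>' $ k" for k
  proof (cases k)
    case (Inl i)
    then show ?thesis using that[of i] by (simp add: slice_def)
  next
    case (Inr ij)
    then show ?thesis using that[of "fst ij"] by (simp add: slice_def vec_eq_iff) (metis prod.collapse)
  qed
  then show ?thesis by (simp add: vec_eq_iff)
qed

lemma slice_linear: "linear (\<lambda>\<theta>. slice \<theta> j)"
  by (rule linearI) (simp_all add: slice_def vec_eq_iff)

lemmas slice_simps = linear_add[OF slice_linear] linear_diff[OF slice_linear]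
  linear_cmul[OF slice_linear] linear_sum[OF slice_linear] linear_0[OF slice_linear]

lemma slice_elem_tensor [simp]: "slice (elem_tensor x c) j = x $ j *\<^sub>R c"
  by (simp add: slice_def elem_tensor_def vstack_def kron_vec_def prod_eq_iff vec_eq_iff)

lemma inner_slices: "\<theta> \<bullet> \<theta>' = (\<Sum>j\<in>UNIV. slice \<theta> j \<bullet> slice \<theta>' j)"
  by (simp add: inner_vec_def[of \<theta>] sum_UNIV_Plus sum_UNIV_Times slice_def inner_vec_def
      sum.distrib)

lemma inner_elem_tensor: "elem_tensor x c \<bullet> \<theta> = x \<bullet> contract c \<theta>"
  by (simp add: inner_slices contract_def inner_vec_def)

lemma inner_elem_tensor_right: "\<theta> \<bullet> elem_tensor x c = contract c \<theta> \<bullet> x"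
  by (simp add: inner_commute[of \<theta>] inner_commute[of _ x] inner_elem_tensor)

lemma contract_elem_tensor: "contract c (elem_tensor x c') = (c \<bullet> c') *\<^sub>R x"
  by (simp add: contract_def vec_eq_iff mult.commute)

lemma elem_tensor_scaleR_left: "elem_tensor (r *\<^sub>R x) c = r *\<^sub>R elem_tensor x c"
  and elem_tensor_scaleR_right: "elem_tensor x (r *\<^sub>R c) = r *\<^sub>R elem_tensor x c"
  and elem_tensor_add_left: "elem_tensor (x + x') c = elem_tensor x c + elem_tensor x' c"
  and elem_tensor_sum_right: "elem_tensor x (\<Sum>i\<in>I. cs i) = (\<Sum>i\<in>I. elem_tensor x (cs i))"
  by (rule slice_eqI, simp add: slice_simps algebra_simps scaleR_sum_right)+

section \<open>Observations and prior precision as operators\<close>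

text \<open>The discrepancy model is affine in the input \<open>z\<close>. In tensor form, observing it means pairing
  the second factor with \<open>(1, Mz *v z)\<close>; everything below depends on the inputs only through
  these vectors.\<close>

lemma obs_block_mult:
  assumes "transpose Mz = Mz"
  shows "obs_block Mz z *v \<theta> = contract (1, Mz *v z) \<theta>"
proof -
  have "z v* Mz = Mz *v z" using assms by (metis transpose_matrix_vector)
  then show ?thesis
    by (simp add: vec_eq_iff obs_block_def hstack_def vstack_def kron_row_def contract_def slice_def
      matrix_vector_mult_def[of "vec_lambda _"] sum_UNIV_Plus sum_UNIV_Times mat_def inner_vec_def
      if_distrib[of "\<lambda>r. r * _"] if_distribR sum_if_zero cong: if_cong)
qed

lemma obs_matrix_mult:
  assumes "transpose Mz = Mz"
  shows "obs_matrix Mz z *v \<theta> = data_vec (\<lambda>l. contract (1, Mz *v z l) \<theta>)"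
proof -
  have "(obs_matrix Mz z *v \<theta>) $ i = (obs_block Mz (z (fst i)) *v \<theta>) $ snd i" for i
    by (simp add: obs_matrix_def matrix_vector_mult_def)
  then show ?thesis by (simp add: vec_eq_iff data_vec_def obs_block_mult[OF assms])
qed

lemma inner_data_vec: "data_vec w \<bullet> data_vec w' = (\<Sum>l\<in>UNIV. w l \<bullet> w' l)"
  by (simp add: inner_vec_def data_vec_def sum_UNIV_Times)

lemma obs_matrix_transpose_mult:
  assumes "transpose Mz = Mz"
  shows "transpose (obs_matrix Mz z) *v data_vec w = (\<Sum>l\<in>UNIV. elem_tensor (w l) (1, Mz *v z l))"
proof -
  have "\<theta> \<bullet> (transpose (obs_matrix Mz z) *v data_vec w)
      = \<theta> \<bullet> (\<Sum>l\<in>UNIV. elem_tensor (w l) (1, Mz *v z l))" for \<theta>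
  proof -
    have "\<theta> \<bullet> (transpose (obs_matrix Mz z) *v data_vec w) = data_vec w \<bullet> (obs_matrix Mz z *v \<theta>)"
      by (simp add: dot_lmul_matrix inner_commute[of \<theta>])
    also have "\<dots> = (\<Sum>l\<in>UNIV. elem_tensor (w l) (1, Mz *v z l) \<bullet> \<theta>)"
      by (simp add: obs_matrix_mult[OF assms] inner_data_vec inner_elem_tensor)
    finally show ?thesis by (simp add: inner_sum_left inner_commute[of \<theta>])
  qed
  then show ?thesis using vector_eq_ldot by blast
qed

lemma kron_id_mult: "kron (mat 1) Mu *v data_vec w = data_vec (\<lambda>l. Mu *v w l)"
  by (simp add: vec_eq_iff kron_def data_vec_def matrix_vector_mult_def sum_UNIV_Times mat_def
      if_distrib[of "\<lambda>r. r * _"] if_distribR sum_if_zero cong: if_cong)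

text \<open>The prior precision is a Kronecker product of \<open>Wu\<close> and a matrix on \<open>\<real> \<times> \<real>\<^sup>n\<close>. This is that
  second factor \<open>B\<close>, as an operator.\<close>

definition input_precision ::
    "real^'n^'n \<Rightarrow> real^'n^'n \<Rightarrow> real^'n \<Rightarrow> real \<times> (real^'n::finite) \<Rightarrow> real \<times> (real^'n)" where
  "input_precision Mz Wz zt c =
     (fst c + (zt v* Mz) \<bullet> snd c,
      fst c *\<^sub>R (Mz *v zt) + (Mz ** (Wz + outer zt zt) ** Mz) *v snd c)"

text \<open>This is the identity \<open>W = Wu \<otimes> B\<close> for the prior precision \<open>W\<close>, in coordinates.\<close>

lemma slice_prior_precision_mult:
  "slice (prior_precision Mz Wu Wz zt *v \<theta>) i
    = (\<Sum>j\<in>UNIV. Wu $ i $ j *\<^sub>R input_precision Mz Wz zt (slice \<theta> j))"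
proof -
  define p where "p = zt v* Mz"
  define q where "q = Mz *v zt"
  define K where "K = Mz ** (Wz + outer zt zt) ** Mz"
  let ?W = "vstack (hstack Wu (kron_row Wu p)) (hstack (kron_col Wu q) (kron Wu K))"
  have W: "prior_precision Mz Wu Wz zt = ?W"
    by (simp add: prior_precision_def p_def q_def K_def)
  have B: "input_precision Mz Wz zt c = (fst c + p \<bullet> snd c, fst c *\<^sub>R q + K *v snd c)" for c
    by (simp add: input_precision_def p_def q_def K_def)
  have "(?W *v \<theta>) $ Inl i = (\<Sum>j\<in>UNIV. Wu $ i $ j * (fst (slice \<theta> j) + p \<bullet> snd (slice \<theta> j)))"
    by (simp add: matrix_vector_mult_def sum_UNIV_Plus sum_UNIV_Times vstack_def hstack_def
        kron_row_def slice_def inner_vec_def sum.distrib sum_distrib_left distrib_left mult.assoc)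
  moreover have "(?W *v \<theta>) $ Inr (i, k)
      = (\<Sum>j\<in>UNIV. Wu $ i $ j * (fst (slice \<theta> j) * q $ k + (K *v snd (slice \<theta> j)) $ k))" for k
    by (simp add: matrix_vector_mult_def sum_UNIV_Plus sum_UNIV_Times vstack_def hstack_def
        kron_col_def kron_def slice_def sum.distrib sum_distrib_left distrib_left mult_ac)
  ultimately have "fst (slice (?W *v \<theta>) i)
        = fst (\<Sum>j\<in>UNIV. Wu $ i $ j *\<^sub>R input_precision Mz Wz zt (slice \<theta> j))"
      and "snd (slice (?W *v \<theta>) i)
        = snd (\<Sum>j\<in>UNIV. Wu $ i $ j *\<^sub>R input_precision Mz Wz zt (slice \<theta> j))"
    unfolding slice_def[of "_ *v _"] B by (simp_all add: fst_sum snd_sum vec_eq_iff)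
  then show ?thesis unfolding W by (rule prod_eqI)
qed

text \<open>The lower right block of \<open>B\<close> contains the outer product of \<open>Mz *v zt\<close> with itself, which is
  exactly what completes the square with the other three blocks.\<close>

lemma input_precision_eq:
  assumes "transpose Mz = Mz"
  shows "input_precision Mz Wz zt c
    = ((1, Mz *v zt) \<bullet> c) *\<^sub>R (1, Mz *v zt) + (0, Mz *v (Wz *v (Mz *v snd c)))"
proof -
  have 1: "zt v* Mz = Mz *v zt" using assms by (metis transpose_matrix_vector)
  have 2: "zt \<bullet> (Mz *v q) = (Mz *v zt) \<bullet> q" for q
    by (rule symmetric_inner_commute[OF assms])
  show ?thesis
    by (cases c) (simp add: input_precision_def 1 2 matrix_vector_mul_assoc[symmetric]
        matrix_vector_mult_add_rdistrib matrix_vector_right_distrib outer_mult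
        matrix_vector_mult_scaleR scaleR_add_left)
qed

lemma input_precision_scaleR:
  "input_precision Mz Wz zt (r *\<^sub>R c) = r *\<^sub>R input_precision Mz Wz zt c"
  by (simp add: input_precision_def matrix_vector_mult_scaleR scaleR_add_right distrib_left)

lemma prior_precision_elem_tensor:
  "prior_precision Mz Wu Wz zt *v elem_tensor x c
    = elem_tensor (Wu *v x) (input_precision Mz Wz zt c)"
  by (rule slice_eqI)
    (simp add: slice_prior_precision_mult input_precision_scaleR matrix_vector_mult_def[of Wu]
      scaleR_sum_left)

text \<open>The vector that represents an input \<open>z\<close> in the second tensor factor, and its directional
  derivative in \<open>z\<close>.\<close>

abbreviation feature :: "real^'n^'n \<Rightarrow> real^'n \<Rightarrow> real \<times> (real^'n)" where
  "feature Mz z \<equiv> (1, Mz *v z)"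

abbreviation feature_deriv :: "real^'n^'n \<Rightarrow> real^'n \<Rightarrow> real \<times> (real^'n)" where
  "feature_deriv Mz w \<equiv> (0, Mz *v w)"

lemma input_precision_inner:
  assumes "transpose Mz = Mz"
  shows "c' \<bullet> input_precision Mz Wz zt c
    = (feature Mz zt \<bullet> c') * (feature Mz zt \<bullet> c) + (Mz *v snd c') \<bullet> (Wz *v (Mz *v snd c))"
proof -
  have "c' \<bullet> feature_deriv Mz w = (Mz *v snd c') \<bullet> w" for w
    by (cases c') (simp add: symmetric_inner_commute[OF assms])
  then show ?thesis
    by (simp add: input_precision_eq[OF assms] inner_add_right inner_commute[of c' "feature _ _"]
        del: add_Pair scaleR_Pair)
qed

text \<open>Every application of the inverse of \<open>B\<close> in the formula for the posterior mean has this form: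
  \<open>\<tau> = 1\<close> and \<open>y = z l - zt\<close> give the preimage of \<open>feature Mz (z l)\<close>, and
  \<open>\<tau> = ones \<bullet> g i\<close> and \<open>y = y i\<close> the preimage of its combination with weights \<open>g i\<close>.\<close>

lemma input_precision_solve:
  assumes Mz: "sym_pos_def Mz" and Wz: "sym_pos_def Wz"
  shows "input_precision Mz Wz zt
      (\<tau> - zt \<bullet> (matrix_inv Wz *v y), matrix_inv Mz *v (matrix_inv Wz *v y))
    = (\<tau>, Mz *v (y + \<tau> *\<^sub>R zt))"
proof -
  have sym: "transpose Mz = Mz" using Mz by (simp add: sym_pos_def_def)
  show ?thesis
    by (simp add: input_precision_eq[OF sym] sym_pos_def_inner_commute[OF Mz, symmetric]
        sym_pos_def_mult_inv[OF Mz] sym_pos_def_mult_inv[OF Wz] matrix_vector_right_distrib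
        matrix_vector_mult_scaleR)
qed

text \<open>A factorization of \<open>Wz\<close> into squares yields one of \<open>B\<close>, and thereby writes the prior precision
  as a sum of copies of \<open>Wu\<close>, each seen through a contraction.\<close>

lemma input_precision_sum_of_squares:
  assumes "transpose Mz = Mz" and r: "\<And>x. Wz *v x = (\<Sum>k\<in>UNIV. (r k \<bullet> x) *\<^sub>R r k)"
  shows "input_precision Mz Wz zt c = (feature Mz zt \<bullet> c) *\<^sub>R feature Mz zt
    + (\<Sum>k\<in>UNIV. ((feature_deriv Mz (r k)) \<bullet> c) *\<^sub>R (feature_deriv Mz (r k)))"
proof -
  have "(feature_deriv Mz (r k)) \<bullet> c = r k \<bullet> (Mz *v snd c)" for k
    by (cases c) (simp add: symmetric_inner_commute[OF assms(1)])
  then have "feature_deriv Mz (Wz *v (Mz *v snd c)) = (\<Sum>k\<in>UNIV. ((feature_deriv Mz (r k)) \<bullet> c) *\<^sub>R (feature_deriv Mz (r k)))"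
    by (simp add: prod_eq_iff fst_sum snd_sum r linear_sum[OF matrix_vector_mul_linear]
        matrix_vector_mult_scaleR)
  then show ?thesis by (simp only: input_precision_eq[OF assms(1)])
qed

lemma prior_precision_sum_of_squares:
  assumes "transpose Mz = Mz" and "\<And>x. Wz *v x = (\<Sum>k\<in>UNIV. (r k \<bullet> x) *\<^sub>R r k)"
  shows "prior_precision Mz Wu Wz zt *v \<theta>
    = elem_tensor (Wu *v contract (feature Mz zt) \<theta>) (feature Mz zt)
      + (\<Sum>k\<in>UNIV. elem_tensor (Wu *v contract (feature_deriv Mz (r k)) \<theta>) (feature_deriv Mz (r k)))"
proof (rule slice_eqI)
  fix i
  have *: "(Wu *v contract c \<theta>) $ i = (\<Sum>j\<in>UNIV. Wu $ i $ j * (c \<bullet> slice \<theta> j))" for c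
    by (simp add: matrix_vector_mult_def contract_def)
  define c where "c k = (feature_deriv Mz (r k))" for k
  define c0 where "c0 = feature Mz zt"
  have "slice (prior_precision Mz Wu Wz zt *v \<theta>) i
      = (\<Sum>j\<in>UNIV. (Wu $ i $ j * (c0 \<bullet> slice \<theta> j)) *\<^sub>R c0)
        + (\<Sum>j\<in>UNIV. \<Sum>k\<in>UNIV. (Wu $ i $ j * (c k \<bullet> slice \<theta> j)) *\<^sub>R c k)"
    unfolding slice_prior_precision_mult input_precision_sum_of_squares[OF assms]
      c_def[symmetric] c0_def[symmetric]
    by (simp add: scaleR_add_right scaleR_sum_right sum.distrib)
  also have "\<dots> = (Wu *v contract c0 \<theta>) $ i *\<^sub>R c0 + (\<Sum>k\<in>UNIV. (Wu *v contract (c k) \<theta>) $ i *\<^sub>R c k)"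
    unfolding * scaleR_sum_left by (subst sum.swap) simp
  finally show "slice (prior_precision Mz Wu Wz zt *v \<theta>) i
      = slice (elem_tensor (Wu *v contract (feature Mz zt) \<theta>) (feature Mz zt)
        + (\<Sum>k\<in>UNIV. elem_tensor (Wu *v contract (feature_deriv Mz (r k)) \<theta>) (feature_deriv Mz (r k)))) i"
    by (simp only: slice_simps slice_elem_tensor c_def c0_def)
qed

lemma prior_precision_sym_pos_def:
  fixes Wu :: "real^'m^'m" and Mz Wz :: "real^'n^'n"
  assumes Mz: "sym_pos_def Mz" and Wu: "sym_pos_def Wu" and Wz: "sym_pos_def Wz"
  shows "sym_pos_def (prior_precision Mz Wu Wz zt)"
proof -
  have sym: "transpose Mz = Mz" using Mz by (simp add: sym_pos_def_def)
  obtain r :: "'n \<Rightarrow> real^'n" where r: "\<And>x. Wz *v x = (\<Sum>k\<in>UNIV. (r k \<bullet> x) *\<^sub>R r k)"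
    using sym_pos_def_sum_of_squares[OF Wz] by blast
  define c where "c k = (feature_deriv Mz (r k))" for k
  define c0 where "c0 = feature Mz zt"
  let ?W = "prior_precision Mz Wu Wz zt"
  have inner: "\<theta> \<bullet> (?W *v \<theta>') = contract c0 \<theta> \<bullet> (Wu *v contract c0 \<theta>')
      + (\<Sum>k\<in>UNIV. contract (c k) \<theta> \<bullet> (Wu *v contract (c k) \<theta>'))" for \<theta> \<theta>'
    unfolding inner_commute[of \<theta>] prior_precision_sum_of_squares[OF sym r] c_def c0_def
    by (simp add: inner_add_left inner_sum_left inner_elem_tensor inner_commute[of "Wu *v _"])
  show ?thesis
  proof (rule sym_pos_defI)
    show "\<theta> \<bullet> (?W *v \<theta>') = (?W *v \<theta>) \<bullet> \<theta>'" for \<theta> \<theta>'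
      unfolding inner_commute[of "?W *v \<theta>"] inner
      by (simp only: sym_pos_def_inner_swap[OF Wu])
  next
    fix \<theta> :: "real^('m + 'm \<times> 'n)"
    assume "\<theta> \<noteq> 0"
    have nonneg: "0 \<le> \<theta> \<bullet> (?W *v \<theta>)"
      unfolding inner by (intro add_nonneg_nonneg sum_nonneg sym_pos_def_nonneg[OF Wu])
    moreover have "\<theta> \<bullet> (?W *v \<theta>) \<noteq> 0"
    proof
      assume "\<theta> \<bullet> (?W *v \<theta>) = 0"
      then have "contract c0 \<theta> \<bullet> (Wu *v contract c0 \<theta>) = 0"
        and "(\<Sum>k\<in>UNIV. contract (c k) \<theta> \<bullet> (Wu *v contract (c k) \<theta>)) = 0"
        unfolding inner
        by (simp_all add: add_nonneg_eq_0_iff sum_nonneg sym_pos_def_nonneg[OF Wu])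
      then have "contract c0 \<theta> = 0" "\<And>k. contract (c k) \<theta> = 0"
        by (simp_all add: sum_nonneg_eq_0_iff sym_pos_def_nonneg[OF Wu] sym_pos_def_eq_0[OF Wu])
      \<comment> \<open>The contractions all vanish, so each slice is orthogonal to all vectors of the factorization
        and lies in the kernel of \<open>B\<close>, which is trivial.\<close>
      then have orth: "c0 \<bullet> slice \<theta> j = 0" "c k \<bullet> slice \<theta> j = 0" for j k
        by (simp_all add: contract_def vec_eq_iff)
      have "slice \<theta> j = 0" for j
      proof -
        let ?q = "snd (slice \<theta> j)"
        have "input_precision Mz Wz zt (slice \<theta> j) = 0"
          unfolding input_precision_sum_of_squares[OF sym r] c_def[symmetric] c0_def[symmetric]
          using orth by simp
        then have "(c0 \<bullet> slice \<theta> j) * (c0 \<bullet> slice \<theta> j) + (Mz *v ?q) \<bullet> (Wz *v (Mz *v ?q)) = 0"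
          using input_precision_inner[OF sym, of "slice \<theta> j" Wz zt "slice \<theta> j"]
          by (simp add: c0_def)
        then have "Mz *v ?q = 0" using orth by (simp add: sym_pos_def_eq_0[OF Wz])
        then have "?q = 0" using sym_pos_def_mult_inv(2)[OF Mz, of ?q] by simp
        then show ?thesis using orth(1)[of j] by (cases "slice \<theta> j") (simp add: c0_def zero_prod_def)
      qed
      then have "\<theta> = 0" by (intro slice_eqI) (simp add: slice_simps)
      with \<open>\<theta> \<noteq> 0\<close> show False by simp
    qed
    ultimately show "0 < \<theta> \<bullet> (?W *v \<theta>)" by simp
  qed
qed

section \<open>The posterior density\<close>

definition posterior_precision ::
    "real \<Rightarrow> real^'m^'m \<Rightarrow> real^'n^'n \<Rightarrow> real^'m^'m \<Rightarrow> real^'n^'n \<Rightarrow> real^'n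
      \<Rightarrow> ('N::finite \<Rightarrow> real^'n) \<Rightarrow> real^('m::finite + 'm \<times> 'n)^('m + 'm \<times> 'n)" where
  "posterior_precision \<alpha> Mu Mz Wu Wz zt z =
     prior_precision Mz Wu Wz zt + (1 / \<alpha>) *\<^sub>R
       (transpose (obs_matrix Mz z :: real^('m + 'm \<times> 'n)^('N \<times> 'm)) ** kron (mat 1) Mu
         ** obs_matrix Mz z)"

text \<open>The data term of the posterior precision: contract with each feature, weight by \<open>Mu\<close>, and
  tensor back with the same feature.\<close>

lemma gram_mult:
  fixes Mu :: "real^'m^'m" and Mz :: "real^'n^'n" and z :: "'N::finite \<Rightarrow> real^'n"
  assumes "transpose Mz = Mz"
  shows "(transpose (obs_matrix Mz z :: real^('m + 'm \<times> 'n)^('N \<times> 'm)) ** kron (mat 1) Mu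
      ** obs_matrix Mz z) *v \<theta>
    = (\<Sum>l\<in>UNIV. elem_tensor (Mu *v contract (feature Mz (z l)) \<theta>) (feature Mz (z l)))"
  by (simp add: matrix_vector_mul_assoc[symmetric] obs_matrix_mult[OF assms] kron_id_mult
      obs_matrix_transpose_mult[OF assms] del: transpose_matrix_vector)

lemma posterior_precision_mult:
  fixes z :: "'N::finite \<Rightarrow> real^'n"
  assumes "transpose Mz = Mz"
  shows "posterior_precision \<alpha> Mu Mz Wu Wz zt z *v \<theta> = prior_precision Mz Wu Wz zt *v \<theta>
    + (1 / \<alpha>) *\<^sub>R (\<Sum>l\<in>UNIV. elem_tensor (Mu *v contract (feature Mz (z l)) \<theta>) (feature Mz (z l)))"
  unfolding posterior_precision_def gram_mult[OF assms, symmetric]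
  by (simp only: matrix_vector_mult_add_rdistrib scaleR_matrix_vector_assoc)

lemma posterior_precision_inner:
  assumes "transpose Mz = Mz"
  shows "\<theta>' \<bullet> (posterior_precision \<alpha> Mu Mz Wu Wz zt z *v \<theta>)
    = \<theta>' \<bullet> (prior_precision Mz Wu Wz zt *v \<theta>)
      + (1 / \<alpha>) * (\<Sum>l\<in>UNIV. contract (feature Mz (z l)) \<theta>' \<bullet> (Mu *v contract (feature Mz (z l)) \<theta>))"
  by (simp add: posterior_precision_mult[OF assms] inner_add_right inner_sum_right
      inner_elem_tensor_right)

lemma posterior_precision_sym_pos_def:
  assumes Mu: "sym_pos_def Mu" and Mz: "sym_pos_def Mz" and Wu: "sym_pos_def Wu"
    and Wz: "sym_pos_def Wz" and "\<alpha> > 0"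
  shows "sym_pos_def (posterior_precision \<alpha> Mu Mz Wu Wz zt z)"
proof -
  have sym: "transpose Mz = Mz" using Mz by (simp add: sym_pos_def_def)
  note W = prior_precision_sym_pos_def[OF Mz Wu Wz, of zt]
  show ?thesis
    unfolding posterior_precision_def
  proof (rule sym_pos_def_add_semidef[OF W])
    let ?G = "transpose (obs_matrix Mz z) ** kron (mat 1) Mu ** obs_matrix Mz z"
    have inner: "x \<bullet> (?G *v y)
        = (\<Sum>l\<in>UNIV. contract (feature Mz (z l)) x \<bullet> (Mu *v contract (feature Mz (z l)) y))" for x y
      unfolding gram_mult[OF sym] by (simp add: inner_sum_right inner_elem_tensor_right)
    show "x \<bullet> (?G *v y) = (?G *v x) \<bullet> y" for x y
      unfolding inner_commute[of "?G *v x"] inner by (simp only: sym_pos_def_inner_swap[OF Mu])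
    show "0 \<le> x \<bullet> (?G *v x)" for x
      unfolding inner by (intro sum_nonneg sym_pos_def_nonneg[OF Mu])
    show "0 \<le> 1 / \<alpha>" using \<open>\<alpha> > 0\<close> by simp
  qed
qed

text \<open>Prior and likelihood are exponentials of quadratic forms whose Hessians add up to the posterior
  precision. Completing the square moves the centre to the solution \<open>m\<close> of the normal equations; the
  remainder \<open>\<kappa>\<close> and the normalizing constants go into \<open>K\<close>.\<close>

lemma joint_density_gaussian:
  fixes Mu Wu :: "real^'m^'m" and Mz Wz :: "real^'n^'n" and z :: "'N::finite \<Rightarrow> real^'n"
  assumes Mu: "sym_pos_def Mu" and Mz: "sym_pos_def Mz" and Wu: "sym_pos_def Wu"
    and Wz: "sym_pos_def Wz" and "\<alpha> > 0"
    and m: "posterior_precision \<alpha> Mu Mz Wu Wz zt z *v m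
      = (1 / \<alpha>) *\<^sub>R (\<Sum>l\<in>UNIV. elem_tensor (Mu *v d l) (feature Mz (z l)))"
  obtains K where "K \<noteq> 0"
    and "\<And>\<theta>. prior_density Mz Wu Wz zt \<theta> * likelihood \<alpha> Mu Mz z d \<theta>
      = K * exp (- ((\<theta> - m) \<bullet> (posterior_precision \<alpha> Mu Mz Wu Wz zt z *v (\<theta> - m))) / 2)"
proof -
  have sym: "transpose Mz = Mz" using Mz by (simp add: sym_pos_def_def)
  let ?W = "prior_precision Mz Wu Wz zt"
  let ?P = "posterior_precision \<alpha> Mu Mz Wu Wz zt z"
  let ?c = "\<lambda>l. feature Mz (z l)"
  note W = prior_precision_sym_pos_def[OF Mz Wu Wz, of zt]
  note P = posterior_precision_sym_pos_def[OF Mu Mz Wu Wz \<open>\<alpha> > 0\<close>, of zt z]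
  define k0 where "k0 = sqrt ((2 * pi) ^ CARD('m + 'm \<times> 'n) * det (matrix_inv ?W))"
  define k1 where "k1 = sqrt ((2 * pi) ^ CARD('m) * det (\<alpha> *\<^sub>R matrix_inv Mu))"
  have "k0 \<noteq> 0"
    using sym_pos_def_det_nonzero[OF sym_pos_def_inv[OF W]] by (simp add: k0_def)
  have "k1 \<noteq> 0"
    using sym_pos_def_det_nonzero[OF sym_pos_def_scaleR[OF sym_pos_def_inv[OF Mu] \<open>\<alpha> > 0\<close>]]
    by (simp add: k1_def)
  have prior: "prior_density Mz Wu Wz zt \<theta> = exp (- (\<theta> \<bullet> (?W *v \<theta>)) / 2) / k0" for \<theta>
    by (simp add: prior_density_def gaussian_density_def sym_pos_def_inv_inv[OF W] k0_def)
  define e where "e \<theta> l = d l - contract (?c l) \<theta>" for \<theta> l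
  have "likelihood \<alpha> Mu Mz z d \<theta>
      = (\<Prod>l\<in>UNIV. exp (- ((1 / \<alpha>) * (e \<theta> l \<bullet> (Mu *v e \<theta> l))) / 2) / k1)" for \<theta>
    unfolding likelihood_def gaussian_density_def discrepancy_def obs_block_mult[OF sym]
      sym_pos_def_inv_scaleR_inv[OF Mu \<open>\<alpha> > 0\<close>] k1_def[symmetric] e_def
    by (simp add: scaleR_matrix_vector_assoc[symmetric])
  then have lik: "likelihood \<alpha> Mu Mz z d \<theta>
      = exp (- ((1 / \<alpha>) * (\<Sum>l\<in>UNIV. e \<theta> l \<bullet> (Mu *v e \<theta> l))) / 2) / k1 ^ CARD('N)" for \<theta>
    by (simp add: prod_dividef exp_sum[symmetric] sum_distrib_left sum_negf sum_divide_distrib)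
  define \<kappa> where "\<kappa> = (1 / \<alpha>) * (\<Sum>l\<in>UNIV. d l \<bullet> (Mu *v d l)) - m \<bullet> (?P *v m)"
  have square: "\<theta> \<bullet> (?W *v \<theta>) + (1 / \<alpha>) * (\<Sum>l\<in>UNIV. e \<theta> l \<bullet> (Mu *v e \<theta> l))
      = (\<theta> - m) \<bullet> (?P *v (\<theta> - m)) + \<kappa>" for \<theta>
  proof -
    let ?S = "\<lambda>f. \<Sum>l\<in>(UNIV :: 'N set). f l"
    have "e \<theta> l \<bullet> (Mu *v e \<theta> l) = d l \<bullet> (Mu *v d l) - 2 * (contract (?c l) \<theta> \<bullet> (Mu *v d l))
        + contract (?c l) \<theta> \<bullet> (Mu *v contract (?c l) \<theta>)" for l
      using sym_pos_def_inner_swap[OF Mu, of "d l" "contract (?c l) \<theta>"]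
      by (simp add: e_def matrix_vector_mult_diff_distrib inner_diff_left inner_diff_right)
    then have 1: "?S (\<lambda>l. e \<theta> l \<bullet> (Mu *v e \<theta> l)) = ?S (\<lambda>l. d l \<bullet> (Mu *v d l))
        - 2 * ?S (\<lambda>l. contract (?c l) \<theta> \<bullet> (Mu *v d l))
        + ?S (\<lambda>l. contract (?c l) \<theta> \<bullet> (Mu *v contract (?c l) \<theta>))"
      by (simp add: sum.distrib sum_subtractf sum_distrib_left)
    have 2: "\<theta> \<bullet> (?P *v m) = (1 / \<alpha>) * ?S (\<lambda>l. contract (?c l) \<theta> \<bullet> (Mu *v d l))"
      by (simp add: m inner_sum_right inner_elem_tensor_right)
    have 3: "(\<theta> - m) \<bullet> (?P *v (\<theta> - m)) = \<theta> \<bullet> (?P *v \<theta>) - 2 * (\<theta> \<bullet> (?P *v m)) + m \<bullet> (?P *v m)"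
      using sym_pos_def_inner_swap[OF P, of m \<theta>]
      by (simp add: matrix_vector_mult_diff_distrib inner_diff_left inner_diff_right)
    show ?thesis
      unfolding 1 3 2 \<kappa>_def posterior_precision_inner[OF sym, where \<theta>' = \<theta> and \<theta> = \<theta>] by (simp add: algebra_simps)
  qed
  define K where "K = exp (- \<kappa> / 2) / (k0 * k1 ^ CARD('N))"
  have "prior_density Mz Wu Wz zt \<theta> * likelihood \<alpha> Mu Mz z d \<theta>
      = K * exp (- ((\<theta> - m) \<bullet> (?P *v (\<theta> - m))) / 2)" for \<theta>
  proof -
    have "prior_density Mz Wu Wz zt \<theta> * likelihood \<alpha> Mu Mz z d \<theta>
        = exp (- (\<theta> \<bullet> (?W *v \<theta>) + (1 / \<alpha>) * (\<Sum>l\<in>UNIV. e \<theta> l \<bullet> (Mu *v e \<theta> l))) / 2)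
          / (k0 * k1 ^ CARD('N))"
      unfolding prior lik by (simp add: exp_add[symmetric] add_divide_distrib)
    also have "\<dots> = K * exp (- ((\<theta> - m) \<bullet> (?P *v (\<theta> - m))) / 2)"
      unfolding square K_def by (simp add: exp_add[symmetric] add_divide_distrib)
    finally show ?thesis .
  qed
  moreover have "K \<noteq> 0" using \<open>k0 \<noteq> 0\<close> \<open>k1 \<noteq> 0\<close> by (simp add: K_def)
  ultimately show ?thesis using that by blast
qed

lemma posterior_precision_elem_tensor:
  assumes "transpose Mz = Mz"
  shows "posterior_precision \<alpha> Mu Mz Wu Wz zt z *v elem_tensor x c
    = elem_tensor (Wu *v x) (input_precision Mz Wz zt c)
      + elem_tensor ((1 / \<alpha>) *\<^sub>R (Mu *v x)) (\<Sum>l\<in>UNIV. (feature Mz (z l) \<bullet> c) *\<^sub>R feature Mz (z l))"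
  by (simp add: posterior_precision_mult[OF assms] prior_precision_elem_tensor contract_elem_tensor
      matrix_vector_mult_scaleR elem_tensor_scaleR_left elem_tensor_scaleR_right
      elem_tensor_sum_right scaleR_sum_right del: scaleR_Pair)

section \<open>The formula for the posterior mean\<close>

text \<open>If \<open>F\<close> is a generalized eigenvector of the Gram operator of the features relative to \<open>B\<close>, then on
  tensors \<open>x \<otimes> F\<close> both parts of the posterior precision produce a multiple of \<open>B F\<close> in the second
  factor, and inverting it reduces to one \<open>m\<close>-dimensional solve with \<open>\<alpha> Wu + \<mu> Mu\<close>.\<close>

lemma posterior_precision_generalized_eigenvector:
  assumes Mz: "sym_pos_def Mz" and "\<alpha> > 0"
    and S: "sym_pos_def (\<alpha> *\<^sub>R Wu + \<mu> *\<^sub>R Mu)"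
    and F: "(\<Sum>l\<in>UNIV. (feature Mz (z l) \<bullet> F) *\<^sub>R feature Mz (z l)) = \<mu> *\<^sub>R input_precision Mz Wz zt F"
  shows "posterior_precision \<alpha> Mu Mz Wu Wz zt z
      *v elem_tensor (matrix_inv (\<alpha> *\<^sub>R Wu + \<mu> *\<^sub>R Mu) *v w) F
    = (1 / \<alpha>) *\<^sub>R elem_tensor w (input_precision Mz Wz zt F)"
proof -
  have sym: "transpose Mz = Mz" using Mz by (simp add: sym_pos_def_def)
  define x where "x = matrix_inv (\<alpha> *\<^sub>R Wu + \<mu> *\<^sub>R Mu) *v w"
  have "w = (\<alpha> *\<^sub>R Wu + \<mu> *\<^sub>R Mu) *v x" by (simp add: x_def sym_pos_def_mult_inv[OF S])
  also have "\<dots> = \<alpha> *\<^sub>R (Wu *v x + (\<mu> / \<alpha>) *\<^sub>R (Mu *v x))"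
    using \<open>\<alpha> > 0\<close>
    by (simp add: matrix_vector_mult_add_rdistrib scaleR_matrix_vector_assoc[symmetric]
        scaleR_add_right)
  finally have w: "(1 / \<alpha>) *\<^sub>R w = Wu *v x + (\<mu> / \<alpha>) *\<^sub>R (Mu *v x)"
    using \<open>\<alpha> > 0\<close> by simp
  have "posterior_precision \<alpha> Mu Mz Wu Wz zt z *v elem_tensor x F
      = elem_tensor (Wu *v x + (\<mu> / \<alpha>) *\<^sub>R (Mu *v x)) (input_precision Mz Wz zt F)"
    unfolding posterior_precision_elem_tensor[OF sym] F
    by (simp add: elem_tensor_add_left elem_tensor_scaleR_left elem_tensor_scaleR_right)
  then show ?thesis unfolding w[symmetric] elem_tensor_scaleR_left by (simp only: x_def)
qed

theorem theorem4p1: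
  fixes Mu Wu :: "real^'m^'m"
    and Mz Wz :: "real^'n^'n"
    and \<alpha> :: real
    and zt :: "real^'n"
    and z :: "'N::finite \<Rightarrow> real^'n"
    and d :: "'N \<Rightarrow> real^'m"
    and Z :: "real^'N^'n"
    and G :: "real^'N^'N"
    and g :: "'N \<Rightarrow> real^'N"
    and \<mu> :: "'N \<Rightarrow> real"
    and y :: "'N \<Rightarrow> real^'n"
    and s :: "'N \<Rightarrow> real"
    and a :: "'N \<Rightarrow> real"
    and b :: "'N \<Rightarrow> 'N \<Rightarrow> real"
    and u :: "'N \<Rightarrow> real^'m"
    and v :: "'N \<Rightarrow> 'N \<Rightarrow> real^'m"
    and theta_bar :: "real^('m + 'm \<times> 'n)"
  assumes "sym_pos_def Mu" and "sym_pos_def Mz"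
    and "sym_pos_def Wu" and "sym_pos_def Wz"
    and "\<alpha> > 0"
    and "inj z" and "independent (range z)"
    and "Z = (\<chi> i l. z l $ i)"
    and "G = outer ones ones
           + transpose (Z - outer zt ones) ** matrix_inv Wz ** (Z - outer zt ones)"
    and "\<And>i. G *v g i = \<mu> i *\<^sub>R g i"
    and "\<And>i j. g i \<bullet> g j = (if i = j then 1 else 0)"
    and "\<And>i. y i = Z *v g i - (ones \<bullet> g i) *\<^sub>R zt"
    and "\<And>i. s i = ones \<bullet> g i - y i \<bullet> (matrix_inv Wz *v zt)"
    and "\<And>l. a l = 1 - zt \<bullet> (matrix_inv Wz *v (z l - zt))"
    and "\<And>i l. b i l = (z l - zt) \<bullet> (matrix_inv Wz *v (Z *v g i)) + (ones \<bullet> g i) * a l"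
    and "\<And>l. u l = matrix_inv Wu *v (Mu *v d l)"
    and "\<And>i l. v i l = matrix_inv (\<alpha> *\<^sub>R Wu + \<mu> i *\<^sub>R Mu) *v (Mu *v u l)"
    and "theta_bar = (1 / \<alpha>) *\<^sub>R
           (posterior_cov \<alpha> Mu Mz Wu Wz zt z *v
             (transpose (obs_matrix Mz z) *v (kron (mat 1) Mu *v data_vec d)))"
  shows "has_bochner_integral (posterior \<alpha> Mu Mz Wu Wz zt z d) (\<lambda>\<theta>. \<theta>) theta_bar
    \<and> theta_bar = (1 / \<alpha>) *\<^sub>R
           (\<Sum>l\<in>UNIV.
              vstack (a l *\<^sub>R u l)
                     (kron_vec (u l) (matrix_inv Mz *v (matrix_inv Wz *v (z l - zt))))
            - (\<Sum>i\<in>UNIV. b i l *\<^sub>R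
                 vstack (s i *\<^sub>R v i l)
                        (kron_vec (v i l) (matrix_inv Mz *v (matrix_inv Wz *v y i)))))"
proof -
  note Mu = assms(1) and Mz = assms(2) and Wu = assms(3) and Wz = assms(4) and \<alpha> = assms(5)
    and Z = assms(8) and G = assms(9) and eig = assms(10) and orth = assms(11)
    and y = assms(12) and s = assms(13) and a = assms(14) and b = assms(15) and u = assms(16)
    and v = assms(17) and theta_bar = assms(18)
  have sym: "transpose Mz = Mz" using Mz by (simp add: sym_pos_def_def)
  let ?B = "input_precision Mz Wz zt"
  let ?P = "posterior_precision \<alpha> Mu Mz Wu Wz zt z"
  let ?c = "\<lambda>l. feature Mz (z l)"
  \<comment> \<open>In the notation of \<open>input_precision\<close> as \<open>B\<close>: \<open>E l\<close> is the inverse image under \<open>B\<close> of the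
    feature of \<open>z l\<close>, and \<open>F i\<close> that of the combination of all features with weights \<open>g i\<close>.\<close>
  define E where "E l = (a l, matrix_inv Mz *v (matrix_inv Wz *v (z l - zt)))" for l
  define F where "F i = (s i, matrix_inv Mz *v (matrix_inv Wz *v y i))" for i
  have Zg: "Z *v x = (\<Sum>l\<in>UNIV. x $ l *\<^sub>R z l)" for x
    by (simp add: Z vec_eq_iff matrix_vector_mult_def mult.commute)
  have og: "ones \<bullet> x = (\<Sum>l\<in>UNIV. x $ l)" for x :: "real^'N"
    by (simp add: ones_def inner_vec_def)
  have ones_l: "(ones :: real^'N) $ l = 1" for l by (simp add: ones_def)
  have BE: "?B (E l) = ?c l" for l
    using input_precision_solve[OF Mz Wz, of zt 1 "z l - zt"] by (simp add: E_def a)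
  have BF: "?B (F i) = (\<Sum>l\<in>UNIV. g i $ l *\<^sub>R ?c l)" for i
  proof -
    have "?B (F i) = (ones \<bullet> g i, Mz *v (y i + (ones \<bullet> g i) *\<^sub>R zt))"
      unfolding F_def s sym_pos_def_inv_inner_commute[OF Wz, of "y i"]
        inner_commute[of "matrix_inv Wz *v y i"]
      by (rule input_precision_solve[OF Mz Wz])
    also have "\<dots> = (\<Sum>l\<in>UNIV. g i $ l *\<^sub>R ?c l)"
      by (simp add: y Zg og prod_eq_iff fst_sum snd_sum linear_sum[OF matrix_vector_mul_linear]
          matrix_vector_mult_scaleR)
    finally show ?thesis .
  qed
  have B_sym: "c' \<bullet> ?B c = c \<bullet> ?B c'" for c c'
    unfolding input_precision_inner[OF sym] by (simp add: sym_pos_def_inner_swap[OF Wz] mult.commute)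
  have B_nonneg: "0 \<le> c \<bullet> ?B c" for c
    unfolding input_precision_inner[OF sym] by (simp add: sym_pos_def_nonneg[OF Wz])
  \<comment> \<open>The coefficients \<open>b i l\<close> have two readings: as pairings of features with \<open>F i\<close>, and, since \<open>G\<close>
    is the Gram matrix of the features with respect to the inverse of \<open>B\<close>, as components of
    \<open>G *v g i\<close>.\<close>
  have b_feature: "b i l = ?c l \<bullet> F i" for i l
  proof -
    have "b i l = ones \<bullet> g i + (z l - zt) \<bullet> (matrix_inv Wz *v y i)"
      unfolding b a y sym_pos_def_inner_swap[OF sym_pos_def_inv[OF Wz], of zt]
      by (simp add: matrix_vector_mult_diff_distrib matrix_vector_mult_scaleR inner_diff_right
          algebra_simps)
    also have "\<dots> = s i + z l \<bullet> (matrix_inv Wz *v y i)"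
      unfolding s sym_pos_def_inner_swap[OF sym_pos_def_inv[OF Wz], of "y i" zt]
      by (simp add: inner_diff_left)
    also have "\<dots> = ?c l \<bullet> F i"
      by (simp add: F_def sym_pos_def_inner_commute[OF Mz, symmetric] sym_pos_def_mult_inv[OF Mz])
    finally show ?thesis .
  qed
  have b_eig: "b i l = \<mu> i * g i $ l" for i l
  proof -
    have yD: "y i = (Z - outer zt ones) *v g i"
      by (simp add: y matrix_vector_mult_diff_rdistrib outer_mult)
    have "(x v* (Z - outer zt ones)) $ l = (z l - zt) \<bullet> x" for x
      by (simp add: vector_matrix_mult_def inner_vec_def Z outer_def ones_def mult.commute)
    then have "(G *v g i) $ l = ones \<bullet> g i + (z l - zt) \<bullet> (matrix_inv Wz *v y i)"
      by (simp add: G matrix_vector_mult_add_rdistrib outer_mult ones_l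
          matrix_vector_mul_assoc[symmetric] yD[symmetric])
    also have "\<dots> = b i l"
      unfolding b a y sym_pos_def_inner_swap[OF sym_pos_def_inv[OF Wz], of zt]
      by (simp add: matrix_vector_mult_diff_distrib matrix_vector_mult_scaleR inner_diff_right
          algebra_simps)
    finally show ?thesis by (simp add: eig)
  qed
  have gen_eig: "(\<Sum>l\<in>UNIV. (?c l \<bullet> F i) *\<^sub>R ?c l) = \<mu> i *\<^sub>R ?B (F i)" for i
    unfolding BF b_feature[symmetric] b_eig by (simp add: scaleR_sum_right del: scaleR_Pair)
  \<comment> \<open>\<open>\<mu> i\<close> is the value of the form \<open>B\<close> at \<open>F i\<close>, as \<open>g i\<close> is a unit vector.\<close>
  have \<mu>: "0 \<le> \<mu> i" for i
  proof -
    have "F i \<bullet> ?B (F i) = (\<Sum>l\<in>UNIV. g i $ l * b i l)"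
      unfolding BF by (simp add: inner_sum_right b_feature inner_commute[of "F i"] del: scaleR_Pair)
    also have "\<dots> = \<mu> i * (g i \<bullet> g i)"
      by (simp add: b_eig inner_vec_def sum_distrib_left mult_ac)
    finally show ?thesis using B_nonneg[of "F i"] by (simp add: orth)
  qed
  have shifted: "sym_pos_def (\<alpha> *\<^sub>R Wu + \<mu> i *\<^sub>R Mu)" for i
    by (rule sym_pos_def_add_semidef[OF sym_pos_def_scaleR[OF Wu \<alpha>]
        sym_pos_def_inner_commute[OF Mu] sym_pos_def_nonneg[OF Mu] \<mu>])
  \<comment> \<open>Expanding the \<open>l\<close>-th column of \<open>G\<close> in the basis \<open>g\<close>; its coefficients are the \<open>b i l\<close>, by the
    symmetry of \<open>B\<close>.\<close>
  have expand: "(\<Sum>i\<in>UNIV. b i l *\<^sub>R ?B (F i)) = (\<Sum>k\<in>UNIV. (?c k \<bullet> E l) *\<^sub>R ?c k)" for l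
  proof -
    define x where "x = (\<chi> k. ?c k \<bullet> E l)"
    have "x \<bullet> g i = E l \<bullet> ?B (F i)" for i
      unfolding BF by (simp add: x_def inner_vec_def[of "vec_lambda _"] inner_sum_right
          inner_commute[of "E l"] mult.commute del: scaleR_Pair inner_Pair)
    then have "x \<bullet> g i = b i l" for i
      by (simp only: B_sym[of "E l"] BE b_feature inner_commute)
    then have "x $ k = (\<Sum>i\<in>UNIV. b i l * g i $ k)" for k
      using arg_cong[OF orthonormal_expansion[OF orth, of x], of "\<lambda>x. x $ k"] by simp
    then have "(\<Sum>k\<in>UNIV. (?c k \<bullet> E l) *\<^sub>R ?c k) = (\<Sum>k\<in>UNIV. \<Sum>i\<in>UNIV. (b i l * g i $ k) *\<^sub>R ?c k)"
      by (simp add: x_def scaleR_sum_left del: scaleR_Pair inner_Pair)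
    then show ?thesis
      unfolding BF scaleR_sum_right scaleR_scaleR by (subst sum.swap) (simp only:)
  qed
  define T where "T = (\<Sum>l\<in>UNIV. elem_tensor (u l) (E l) - (\<Sum>i\<in>UNIV. b i l *\<^sub>R elem_tensor (v i l) (F i)))"
  define r where "r = (\<Sum>l\<in>UNIV. elem_tensor (Mu *v d l) (?c l))"
  \<comment> \<open>The prior part of the precision turns \<open>u l \<otimes> E l\<close> into the right-hand side. The data part
    leaves an error, which \<open>expand\<close> splits into generalized eigenvectors; the inner sum over \<open>i\<close>
    corrects it exactly.\<close>
  have "?P *v T = r"
  proof -
    have PE: "?P *v elem_tensor (u l) (E l) = elem_tensor (Mu *v d l) (?c l)
        + (1 / \<alpha>) *\<^sub>R elem_tensor (Mu *v u l) (\<Sum>k\<in>UNIV. (?c k \<bullet> E l) *\<^sub>R ?c k)" for l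
      unfolding posterior_precision_elem_tensor[OF sym] BE elem_tensor_scaleR_left
      by (simp add: u sym_pos_def_mult_inv[OF Wu])
    have Pv: "?P *v (\<Sum>i\<in>UNIV. b i l *\<^sub>R elem_tensor (v i l) (F i))
        = (1 / \<alpha>) *\<^sub>R (\<Sum>i\<in>UNIV. b i l *\<^sub>R elem_tensor (Mu *v u l) (?B (F i)))" for l
      by (simp add: linear_sum[OF matrix_vector_mul_linear] matrix_vector_mult_scaleR v
          posterior_precision_generalized_eigenvector[OF Mz \<alpha> shifted gen_eig] scaleR_sum_right mult.commute)
    have Mv: "(1 / \<alpha>) *\<^sub>R (\<Sum>i\<in>UNIV. b i l *\<^sub>R elem_tensor (Mu *v u l) (?B (F i)))
        = (1 / \<alpha>) *\<^sub>R elem_tensor (Mu *v u l) (\<Sum>k\<in>UNIV. (?c k \<bullet> E l) *\<^sub>R ?c k)" for l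
      unfolding expand[symmetric] elem_tensor_sum_right elem_tensor_scaleR_right ..
    show ?thesis
      unfolding T_def r_def linear_sum[OF matrix_vector_mul_linear]
      by (intro sum.cong) (simp_all add: matrix_vector_mult_diff_distrib PE Pv Mv)
  qed
  have P: "sym_pos_def ?P" by (rule posterior_precision_sym_pos_def[OF Mu Mz Wu Wz \<alpha>])
  have bar: "theta_bar = (1 / \<alpha>) *\<^sub>R (matrix_inv ?P *v r)"
    unfolding theta_bar posterior_cov_def Let_def posterior_precision_def[symmetric]
      kron_id_mult obs_matrix_transpose_mult[OF sym] r_def ..
  have normal_eq: "?P *v theta_bar = (1 / \<alpha>) *\<^sub>R r"
    by (simp add: bar matrix_vector_mult_scaleR sym_pos_def_mult_inv[OF P])
  obtain K where "K \<noteq> 0" and joint: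
    "\<And>\<theta>. prior_density Mz Wu Wz zt \<theta> * likelihood \<alpha> Mu Mz z d \<theta>
      = K * exp (- ((\<theta> - theta_bar) \<bullet> (?P *v (\<theta> - theta_bar))) / 2)"
    by (rule joint_density_gaussian[OF Mu Mz Wu Wz \<alpha> normal_eq[unfolded r_def]]) blast
  have "has_bochner_integral (posterior \<alpha> Mu Mz Wu Wz zt z d) (\<lambda>\<theta>. \<theta>) theta_bar"
    unfolding posterior_def Let_def by (rule gaussian_mean[OF P \<open>K \<noteq> 0\<close> joint])
  moreover have "theta_bar = (1 / \<alpha>) *\<^sub>R T"
    unfolding bar \<open>?P *v T = r\<close>[symmetric] by (simp add: sym_pos_def_mult_inv[OF P])
  ultimately show ?thesis
    by (simp add: T_def elem_tensor_def E_def F_def)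
qed

end
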